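(* Let $Q_d$ be the $d$-dimensional Hamming cube and $N = 2^d$. Then \[\log_2 \operatorname{bis}(Q_d) = \left(1-\Theta(1/\sqrt d)\right)\frac N2,\] that is, there exist absolute constants $c_1, c_2>0$ such that for all sufficiently large $d$, \[\left(1-\frac{c_1}{\sqrt d}\right)\frac N2 \le \log_2 \operatorname{bis}(Q_d) \le \left(1-\frac{c_2}{\sqrt d}\right)\frac N2.\]
   Context: $Q_d$ is the graph on the binary strings of length $d$, two strings adjacent iff they differ in exactly one coordinate; $N=|V(Q_d)|=2^d$. A vertex is even (odd) if it has an even (odd) number of 1's; $\mathcal E$ and $\mathcal O$ denote the sets of even and odd vertices, so $Q_d$ is bipartite with parts $\mathcal E,\mathcal O$. An independent set $I$ of $Q_d$ is balanced if $|I\cap\mathcal E| = |I\cap \mathcal O|$. $\operatorname{bis}(Q_d)$ denotes the number of balanced independent sets of $Q_d$ (including the empty set). *)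

theory Defs
  imports Complex_Main "Graph_Theory.Pair_Digraph"
begin

text \<open>Following the library convention, an undirected graph is a symmetric digraph: each edge is
  represented by its two arcs, see \<open>pair_graph_hypercube\<close> below.\<close>

definition binary_strings :: "nat \<Rightarrow> bool list set" where
  "binary_strings d = {x. length x = d}"

definition hypercube :: "nat \<Rightarrow> bool list pair_pre_digraph" where
  "hypercube d = \<lparr> pverts = binary_strings d,
     parcs = {(x, y). x \<in> binary_strings d \<and> y \<in> binary_strings d \<and>
                      card {i. i < d \<and> x ! i \<noteq> y ! i} = 1} \<rparr>"

definition even_vertices :: "nat \<Rightarrow> bool list set" where
  "even_vertices d = {x \<in> pverts (hypercube d). even (count_list x True)}"

definition odd_vertices :: "nat \<Rightarrow> bool list set" where
  "odd_vertices d = {x \<in> pverts (hypercube d). odd (count_list x True)}"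

definition independent_set :: "'a pair_pre_digraph \<Rightarrow> 'a set \<Rightarrow> bool" where
  "independent_set G I \<longleftrightarrow> I \<subseteq> pverts G \<and> (\<forall>x\<in>I. \<forall>y\<in>I. (x, y) \<notin> parcs G)"

definition balanced :: "nat \<Rightarrow> bool list set \<Rightarrow> bool" where
  "balanced d I \<longleftrightarrow> card (I \<inter> even_vertices d) = card (I \<inter> odd_vertices d)"

definition bis :: "nat \<Rightarrow> nat" where
  "bis d = card {I. independent_set (hypercube d) I \<and> balanced d I}"

lemma finite_binary_strings: "finite (binary_strings d)"
  using finite_lists_length_eq[of "UNIV :: bool set" d] by (simp add: binary_strings_def)

lemma card_hypercube: "card (pverts (hypercube d)) = 2 ^ d"
  using card_lists_length_eq[of "UNIV :: bool set" d]
  by (simp add: hypercube_def binary_strings_def)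

lemma pair_graph_hypercube: "pair_graph (hypercube d)"
proof
  show "finite (pverts (hypercube d))"
    by (simp add: hypercube_def finite_binary_strings)
  have "parcs (hypercube d) \<subseteq> binary_strings d \<times> binary_strings d"
    by (auto simp: hypercube_def)
  then show "finite (parcs (hypercube d))"
    by (rule finite_subset) (simp add: finite_binary_strings)
  have "(x, y) \<in> parcs (hypercube d) \<Longrightarrow> (y, x) \<in> parcs (hypercube d)" for x y
  proof -
    have "{i. i < d \<and> x ! i \<noteq> y ! i} = {i. i < d \<and> y ! i \<noteq> x ! i}" by auto
    then show "(x, y) \<in> parcs (hypercube d) \<Longrightarrow> (y, x) \<in> parcs (hypercube d)"
      by (simp add: hypercube_def)
  qed
  then show "symmetric (with_proj (hypercube d))"
    by (auto simp: symmetric_def sym_def arcs_ends_def arc_to_ends_def)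
qed (auto simp: hypercube_def)

lemma finite_balanced_independent_sets:
  "finite {I. independent_set (hypercube d) I \<and> balanced d I}"
  by (rule finite_subset[of _ "Pow (binary_strings d)"])
    (auto simp: independent_set_def hypercube_def finite_binary_strings)

end

theory Submission
  imports Defs "HOL-Real_Asymp.Real_Asymp"
begin

text \<open>
  Lower bound. Take the even vertices of weight below the middle and the odd vertices of weight
  above it. There are no edges between these two sets, they have the same size \<open>a\<close>, and they miss only
  \<open>O(N / sqrt d)\<close> of the \<open>N / 2\<close> vertices one could hope for. By Vandermonde's identity they contain
  \<open>2 a choose a\<close> balanced independent sets.

  Upper bound. By the Kleitman-Winston algorithm, every independent set is a fingerprint of size
  \<open>O(N / d)\<close>, which costs only \<open>O(N log d / d) = o(N / sqrt d)\<close> bits, plus a subset of a container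
  \<open>C\<close>, determined by the fingerprint, that spans a graph of maximum degree at most \<open>d / 10\<close>. Let \<open>M\<close> be the
  vertex set of a maximal matching of \<open>j\<close> edges in \<open>C\<close>. Then \<open>C\<close> has at most
  \<open>2 ^ card C * (3/4) ^ j\<close> independent subsets. Counting edges gives \<open>card C \<le> N / 2 + j / 5\<close>, so a
  matching with \<open>j\<close> of order \<open>N / sqrt d\<close> or more already yields the desired gain. If \<open>j\<close> is smaller,
  removing \<open>M\<close> leaves two large sets of opposite parity with no edge between them, and vertex
  isoperimetry shows that they have at most \<open>(1 - c / sqrt d) N / 2\<close> elements in total.
  Sets with a small even or odd part are balanced only if they are small, so there are few of them.

  The isoperimetric inequality comes from a Bobkov-Talagrand bound on \<open>\<Sum>x\<in>A. sqrt h(x)\<close>, where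
  \<open>h(x)\<close> counts the neighbours of \<open>x\<close> outside \<open>A\<close>.
\<close>

subsection \<open>The recursive structure of the hypercube\<close>

text \<open>Recursion on the word, rather than a condition on positions, splits neighbourhoods along
  the first letter, as inductions on the dimension require.\<close>

fun flips :: "bool list \<Rightarrow> bool list set" where
  "flips [] = {}"
| "flips (b # x) = insert ((\<not> b) # x) (Cons b ` flips x)"

lemma length_flips: "y \<in> flips x \<Longrightarrow> length y = length x"
  by (induction x arbitrary: y) auto

lemma not_in_flips_self: "x \<notin> flips x"
  by (induction x) auto

lemma finite_flips: "finite (flips x)"
  by (induction x) auto

lemma card_flips: "card (flips x) = length x"
proof (induction x)
  case (Cons b x)
  have "(\<not> b) # x \<notin> Cons b ` flips x" by auto
  then show ?case using Cons by (simp add: finite_flips card_image)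
qed simp

lemma flips_subset: "length x = m \<Longrightarrow> flips x \<subseteq> binary_strings m"
  by (auto simp: binary_strings_def length_flips)

lemma parity_flips:
  "y \<in> flips x \<Longrightarrow> even (count_list y True) \<longleftrightarrow> odd (count_list x True)"
  by (induction x arbitrary: y) auto

lemma weight_flips:
  "y \<in> flips x \<Longrightarrow> count_list y True \<le> Suc (count_list x True) \<and> count_list x True \<le> Suc (count_list y True)"
  by (induction x arbitrary: y) (auto, (metis)?)

lemma hamming_dist_Cons:
  "card {i. i < Suc d \<and> (b # x) ! i \<noteq> (c # y) ! i} =
    (if b \<noteq> c then 1 else 0) + card {i. i < d \<and> x ! i \<noteq> y ! i}"
proof -
  have "{i. i < Suc d \<and> (b # x) ! i \<noteq> (c # y) ! i} =
      (if b \<noteq> c then {0} else {}) \<union> Suc ` {i. i < d \<and> x ! i \<noteq> y ! i}"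
    by (auto simp: less_Suc_eq_0_disj)
  then show ?thesis by (auto simp: card_image card_insert_if)
qed

lemma hamming_dist_1_iff:
  "length x = d \<Longrightarrow> length y = d \<Longrightarrow> card {i. i < d \<and> x ! i \<noteq> y ! i} = 1 \<longleftrightarrow> y \<in> flips x"
proof (induction x arbitrary: y d)
  case (Cons b x)
  then obtain c y' where y: "y = c # y'" and l: "length y' = length x"
    by (metis length_Suc_conv)
  have d: "d = Suc (length x)" using Cons.prems by simp
  have 0: "card {i. i < length x \<and> x ! i \<noteq> y' ! i} = 0 \<longleftrightarrow> x = y'"
    using l by (auto simp: list_eq_iff_nth_eq)
  show ?case
    unfolding y d hamming_dist_Cons using Cons.IH[OF refl l] 0 by auto
qed simp

lemma parcs_hypercube: "parcs (hypercube d) = {(x, y). length x = d \<and> y \<in> flips x}"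
proof -
  have "(x, y) \<in> parcs (hypercube d) \<longleftrightarrow> length x = d \<and> y \<in> flips x" for x y
    using hamming_dist_1_iff[of x d y] length_flips[of y x]
    unfolding hypercube_def binary_strings_def by auto
  then show ?thesis by auto
qed

lemma pverts_hypercube: "pverts (hypercube d) = binary_strings d"
  by (simp add: hypercube_def)

lemma flips_sym: "y \<in> flips x \<Longrightarrow> x \<in> flips y"
  by (induction x arbitrary: y) auto

lemma sym_parcs_hypercube: "sym (parcs (hypercube d))"
  by (auto simp: parcs_hypercube sym_def length_flips flips_sym)

lemma binary_strings_Suc:
  "binary_strings (Suc m) = Cons False ` binary_strings m \<union> Cons True ` binary_strings m"
  by (auto simp: binary_strings_def length_Suc_conv image_iff)

lemma card_binary_strings: "card (binary_strings m) = 2 ^ m"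
  using card_hypercube by (simp add: pverts_hypercube)

text \<open>Deleting the first letter identifies each parity class of the \<open>d\<close>-cube with the
  \<open>(d - 1)\<close>-cube; two vertices of different parity are adjacent iff their images are equal or adjacent.\<close>

lemma bij_betw_tl_parity:
  "bij_betw tl {x \<in> binary_strings (Suc m). even (count_list x True) = p} (binary_strings m)"
\<comment> \<open>The parity of the tail and the prescribed parity \<open>p\<close> together
  determine the deleted letter.\<close>
proof (rule bij_betw_byWitness[where f' = "\<lambda>x. ((even (count_list x True) \<noteq> p) # x)"])
qed (auto simp: binary_strings_def length_Suc_conv split: if_splits)

lemma even_vertices_eq: "even_vertices d = {x \<in> binary_strings d. even (count_list x True) = True}"
  by (simp add: even_vertices_def pverts_hypercube)

lemma odd_vertices_eq: "odd_vertices d = {x \<in> binary_strings d. even (count_list x True) = False}"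
  by (simp add: odd_vertices_def pverts_hypercube)

lemmas bij_betw_tl_even = bij_betw_tl_parity[where p = True, folded even_vertices_eq]
lemmas bij_betw_tl_odd = bij_betw_tl_parity[where p = False, folded odd_vertices_eq]

subsection \<open>Isoperimetry\<close>

text \<open>Minkowski's inequality, read off from the triangle inequality in the complex
  plane.\<close>

lemma norm_sum_pair:
  fixes u w :: "'a \<Rightarrow> real"
  shows "sqrt ((\<Sum>x\<in>A. u x)\<^sup>2 + (\<Sum>x\<in>A. w x)\<^sup>2) \<le> (\<Sum>x\<in>A. sqrt ((u x)\<^sup>2 + (w x)\<^sup>2))"
proof -
  have "norm (\<Sum>x\<in>A. Complex (u x) (w x)) \<le> (\<Sum>x\<in>A. norm (Complex (u x) (w x)))"
    by (rule norm_sum)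
  then show ?thesis by (simp add: cmod_def)
qed

text \<open>Here \<open>a\<close> and \<open>b\<close> stand for the densities of a set in its
  larger and smaller half. With r = a(1 - a) and s = (a - b)^2 the claim becomes sqrt 2 (r + s/2)
  \<le> sqrt (2 r^2 + s). Squaring leaves 2s(r + s/4) \<le> s, true since r \<le> 1/4 and s \<le>
  1.\<close>

lemma two_point_inequality:
  fixes a b :: real
  assumes "0 \<le> b" "b \<le> a" "a \<le> 1"
  shows "2 * (sqrt 2 * ((a + b) / 2) * (1 - (a + b) / 2)) \<le>
    sqrt ((sqrt 2 * a * (1 - a))\<^sup>2 + (a - b)\<^sup>2) + sqrt 2 * b * (1 - b)"
proof -
  define r where "r = a * (1 - a)"
  define s where "s = (a - b)\<^sup>2"
  have s: "0 \<le> s" "s \<le> 1" unfolding s_def using assms by (auto intro: power_le_one)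
  have r: "0 \<le> r" "r \<le> 1/4" 
    using assms mult_nonneg_nonneg[of a "1 - a"] zero_le_power2[of "a - 1/2"] by (auto simp: r_def power2_eq_square algebra_simps)
  have "2 * ((a + b) / 2) * (1 - (a + b) / 2) - b * (1 - b) = r + s / 2"
    by (simp add: r_def s_def power2_eq_square field_simps)
  then have e: "2 * (sqrt 2 * ((a + b) / 2) * (1 - (a + b) / 2)) - sqrt 2 * b * (1 - b) = sqrt 2 * (r + s / 2)"
    by (metis (no_types, opaque_lifting) mult.assoc mult.left_commute right_diff_distrib)
  have "s * (r + s / 4) * 2 \<le> s * 1"
    using s r by (intro order.trans[OF eq_refl[OF mult.assoc] mult_left_mono]) auto
  then have "(sqrt 2 * (r + s / 2))\<^sup>2 \<le> (sqrt 2 * a * (1 - a))\<^sup>2 + (a - b)\<^sup>2"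
    by (simp add: power_mult_distrib r_def[symmetric] s_def[symmetric] mult.assoc)
       (simp add: power2_eq_square algebra_simps)
  then have "sqrt 2 * (r + s / 2) \<le> sqrt ((sqrt 2 * a * (1 - a))\<^sup>2 + (a - b)\<^sup>2)"
    by (rule real_le_rsqrt)
  then show ?thesis using e by linarith
qed


text \<open>Proved by induction on the dimension: passing to the two halves adds \<open>1\<close> under the root at each
  point of the larger half missing from the smaller one, so Minkowski's inequality reduces the step to
  the two-point inequality above for the profile \<open>t \<mapsto> sqrt 2 * t * (1 - t)\<close>.\<close>

lemma sqrt_edge_boundary_ge:
  assumes "A \<subseteq> binary_strings m"
  shows "sqrt 2 * (real (card A) / 2 ^ m) * (1 - real (card A) / 2 ^ m) * 2 ^ m
    \<le> (\<Sum>x\<in>A. sqrt (real (card (flips x - A))))"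
  using assms
proof (induction m arbitrary: A)
  case 0
  then have "A = {} \<or> A = {[]}" by (auto simp: binary_strings_def)
  then show ?case by auto
next
  case (Suc m)
  define S where "S = (\<lambda>b. {x. b # x \<in> A})"
  define \<Psi> where "\<Psi> = (\<lambda>A. \<Sum>x\<in>A. sqrt (real (card (flips x - A))))"
  \<comment> \<open>\<open>T b\<close> is the share of half \<open>b\<close> in the sum for
    \<open>A\<close>, while \<open>\<Psi> (S b)\<close> is the sum for that half inside the smaller
    cube; only the former sees the neighbour across the first letter.\<close>
  define T where "T = (\<lambda>b. \<Sum>x\<in>S b. sqrt (real (card (flips (b # x) - A))))"
  define p where "p = (\<lambda>b. real (card (S b)) / 2 ^ m)"
  have S: "S b \<subseteq> binary_strings m" for b
    using Suc.prems by (auto simp: S_def binary_strings_def)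
  then have fin: "finite (S b)" for b
    using finite_binary_strings finite_subset by blast
  have A: "A = Cons False ` S False \<union> Cons True ` S True"
  proof (rule set_eqI)
    fix x
    show "x \<in> A \<longleftrightarrow> x \<in> Cons False ` S False \<union> Cons True ` S True"
    proof (cases x)
      case Nil
      then show ?thesis using Suc.prems by (auto simp: binary_strings_def)
    next
      case (Cons b y)
      then show ?thesis by (cases b) (auto simp: S_def)
    qed
  qed
  have cardA: "card A = card (S False) + card (S True)"
    by (subst A, subst card_Un_disjoint) (auto simp: fin card_image)
  have sumA: "\<Psi> A = T False + T True"
    unfolding \<Psi>_def T_def
    by (subst (1) A, subst sum.union_disjoint) (auto simp: fin sum.reindex simp del: flips.simps)
  have p: "0 \<le> p b" "p b \<le> 1" for b
    using card_mono[OF finite_binary_strings S, of b] of_nat_le_iff[of "card (S b)" "2 ^ m"]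
    by (auto simp: p_def card_binary_strings divide_simps)
  have IH: "sqrt 2 * p b * (1 - p b) * 2 ^ m \<le> \<Psi> (S b)" for b
    using Suc.IH[OF S, of b] by (simp add: \<Psi>_def p_def)
  have T: "sqrt ((\<Psi> (S b))\<^sup>2 + (real (card (S b - S (\<not> b))))\<^sup>2) \<le> T b" for b
  proof -
    have eq: "card (flips (b # x) - A) = card (flips x - S b) + (if x \<in> S (\<not> b) then 0 else 1)" for x
    proof -
      have "flips (b # x) - A = (if x \<in> S (\<not> b) then {} else {(\<not> b) # x}) \<union> Cons b ` (flips x - S b)"
        by (auto simp: S_def)
      moreover have "(\<not> b) # x \<notin> Cons b ` (flips x - S b)" by auto
      ultimately show ?thesis
        by (auto simp: card_image finite_flips)
    qed
    have "(\<Sum>x\<in>S b. if x \<in> S (\<not> b) then 0 else 1 :: real) = real (card (S b - S (\<not> b)))"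
      by (simp add: sum.If_cases fin Diff_eq)
    then have "sqrt ((\<Psi> (S b))\<^sup>2 + (real (card (S b - S (\<not> b))))\<^sup>2) \<le>
        (\<Sum>x\<in>S b. sqrt ((sqrt (real (card (flips x - S b))))\<^sup>2 + (if x \<in> S (\<not> b) then 0 else 1)\<^sup>2))"
      using norm_sum_pair[where A = "S b" and u = "\<lambda>x. sqrt (real (card (flips x - S b)))"
          and w = "\<lambda>x. if x \<in> S (\<not> b) then 0 else 1"]
      by (simp add: \<Psi>_def)
    also have "\<dots> = T b"
      unfolding T_def eq by (intro sum.cong) auto
    finally show ?thesis .
  qed
  have main: "2 * (sqrt 2 * ((p b + p (\<not> b)) / 2) * (1 - (p b + p (\<not> b)) / 2)) * 2 ^ m \<le> T b + T (\<not> b)"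
    if le: "p (\<not> b) \<le> p b" for b
  proof -
    have "card (S b) \<le> card (S b - S (\<not> b)) + card (S (\<not> b))"
      by (metis card_mono fin finite_Un Un_Diff_cancel2 Un_upper1 card_Un_le order.trans finite_Diff)
    then have diff: "(p b - p (\<not> b)) * 2 ^ m \<le> real (card (S b - S (\<not> b)))"
      by (simp add: p_def left_diff_distrib)
    have "sqrt ((sqrt 2 * p b * (1 - p b))\<^sup>2 + (p b - p (\<not> b))\<^sup>2) * 2 ^ m =
        sqrt ((sqrt 2 * p b * (1 - p b) * 2 ^ m)\<^sup>2 + ((p b - p (\<not> b)) * 2 ^ m)\<^sup>2)"
      by (simp add: power_mult_distrib real_sqrt_mult flip: distrib_right)
    also have "\<dots> \<le> sqrt ((\<Psi> (S b))\<^sup>2 + (real (card (S b - S (\<not> b))))\<^sup>2)"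
      using p[of b] le diff IH[of b] by (intro real_sqrt_le_mono add_mono power_mono) auto
    also have "\<dots> \<le> T b" by (rule T)
    finally have 1: "sqrt ((sqrt 2 * p b * (1 - p b))\<^sup>2 + (p b - p (\<not> b))\<^sup>2) * 2 ^ m \<le> T b" .
    \<comment> \<open>In the smaller half the contribution across the first letter is simply
      discarded.\<close>
    have "\<Psi> (S (\<not> b)) \<le> sqrt ((\<Psi> (S (\<not> b)))\<^sup>2 + (real (card (S (\<not> b) - S b)))\<^sup>2)"
      by (rule real_le_rsqrt) simp
    also have "\<dots> \<le> T (\<not> b)" using T[of "\<not> b"] by simp
    finally have 2: "sqrt 2 * p (\<not> b) * (1 - p (\<not> b)) * 2 ^ m \<le> T (\<not> b)"
      using IH[of "\<not> b"] by simp
    have "2 * (sqrt 2 * ((p b + p (\<not> b)) / 2) * (1 - (p b + p (\<not> b)) / 2)) * 2 ^ m \<le>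
      (sqrt ((sqrt 2 * p b * (1 - p b))\<^sup>2 + (p b - p (\<not> b))\<^sup>2) + sqrt 2 * p (\<not> b) * (1 - p (\<not> b))) * 2 ^ m"
      using p le by (intro mult_right_mono two_point_inequality) auto
    also have "\<dots> \<le> T b + T (\<not> b)" using 1 2 by (simp add: distrib_right)
    finally show ?thesis .
  qed
  have "2 * (sqrt 2 * ((p False + p True) / 2) * (1 - (p False + p True) / 2)) * 2 ^ m \<le> T False + T True"
    using main[of False] main[of True] by (cases "p True \<le> p False") (auto simp: add.commute)
  moreover have eq: "real (card A) / 2 ^ Suc m = (p False + p True) / 2"
    by (simp add: cardA p_def field_simps)
  ultimately show ?case
    unfolding eq using sumA by (simp add: \<Psi>_def mult.assoc)
qed

text \<open>The preceding bound is applied to the complement of \<open>S\<close>, whose density t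
  gives the same t(1 - t). Only points of the complement adjacent to \<open>S\<close> contribute to
  the sum, each at most \<open>sqrt m\<close>; the factor \<open>sqrt 2\<close> is given
  away.\<close>

lemma vertex_boundary_ge:
  assumes "S \<subseteq> binary_strings m" "m > 0"
  shows "real (card S) * (2 ^ m - real (card S)) / (2 ^ m * sqrt (real m))
    \<le> real (card ((\<Union>x\<in>S. insert x (flips x)))) - real (card S)"
proof -
  let ?A = "binary_strings m - S" and ?N = "\<Union>x\<in>S. insert x (flips x)"
  have fin: "finite S" using assms finite_binary_strings finite_subset by blast
  have sub: "?N \<subseteq> binary_strings m"
    using assms by (auto simp: binary_strings_def length_flips subset_iff)
  then have finN: "finite ?N" using finite_binary_strings finite_subset by blast
  have cS: "card S \<le> 2 ^ m"
    using card_mono[OF finite_binary_strings assms(1)] by (simp add: card_binary_strings)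
  have cA: "real (card ?A) = 2 ^ m - real (card S)"
    using assms fin cS by (simp add: card_Diff_subset card_binary_strings of_nat_diff)
  have "(\<Sum>x\<in>?A. sqrt (real (card (flips x - ?A)))) \<le> (\<Sum>x\<in>?A. if x \<in> ?N then sqrt (real m) else 0)"
  proof (rule sum_mono)
    fix x assume x: "x \<in> ?A"
    then have l: "length x = m" by (simp add: binary_strings_def)
    have "flips x - ?A \<subseteq> S" using flips_subset[OF l] by auto
    then have "flips x - ?A = {}" if "x \<notin> ?N" using that flips_sym by blast
    then have "card (flips x - ?A) = 0" if "x \<notin> ?N" using that by (metis card.empty)
    moreover have "card (flips x - ?A) \<le> m"
      using card_mono[OF finite_flips, of "flips x - ?A" x] l by (simp add: card_flips)
    ultimately show "sqrt (real (card (flips x - ?A))) \<le> (if x \<in> ?N then sqrt (real m) else 0)"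
      by (cases "x \<in> ?N") simp_all
  qed
  also have "\<dots> = real (card (?A \<inter> ?N)) * sqrt (real m)"
    by (subst sum.inter_restrict[symmetric]) (auto simp: finite_binary_strings)
  also have "?A \<inter> ?N = ?N - S" using sub by auto
  also have "real (card (?N - S)) = real (card ?N) - real (card S)"
  proof -
    have "S \<subseteq> ?N" by auto
    then show ?thesis
      using fin card_mono[OF finN] by (simp add: card_Diff_subset of_nat_diff)
  qed
  finally have 1: "sqrt 2 * (real (card ?A) / 2 ^ m) * (1 - real (card ?A) / 2 ^ m) * 2 ^ m \<le>
      (real (card ?N) - real (card S)) * sqrt (real m)"
    using sqrt_edge_boundary_ge[of ?A m] by auto
  have "real (card S) * (2 ^ m - real (card S)) / 2 ^ m * 1 \<le> real (card S) * (2 ^ m - real (card S)) / 2 ^ m * sqrt 2"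
    using cA by (intro mult_left_mono) (auto simp flip: cA)
  also have "\<dots> = sqrt 2 * (real (card ?A) / 2 ^ m) * (1 - real (card ?A) / 2 ^ m) * 2 ^ m"
    unfolding cA by (simp add: field_simps)
  finally have "real (card S) * (2 ^ m - real (card S)) / 2 ^ m \<le>
      (real (card ?N) - real (card S)) * sqrt (real m)"
    using 1 by simp
  then show ?thesis
    using assms(2) by (simp add: pos_divide_le_eq flip: divide_divide_eq_left)
qed

subsection \<open>Containers and matchings\<close>

text \<open>While some \<open>v\<close> has at least \<open>k\<close> neighbours in
  \<open>C\<close>, branch on whether \<open>v\<close> lies in \<open>I\<close>: if so, record
  \<open>v\<close> and delete it with its neighbours, otherwise delete \<open>v\<close> alone. The
  choice of \<open>v\<close> depends on \<open>C\<close> only, so the recorded set \<open>F\<close>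
  already determines the container \<open>f F\<close>.\<close>

lemma graph_container:
  fixes E :: "('a \<times> 'a) set"
  assumes "finite C"
  shows "\<exists>f. (\<forall>F. f F \<subseteq> C \<and> (\<forall>x\<in>f F. card (E `` {x} \<inter> f F) < k)) \<and>
    (\<forall>I\<subseteq>C. E \<inter> I \<times> I = {} \<longrightarrow> (\<exists>F\<subseteq>I. card F * k \<le> card C \<and> I \<subseteq> F \<union> f F))"
  using assms
proof (induction "card C" arbitrary: C rule: less_induct)
  case less
  show ?case
  proof (cases "\<forall>x\<in>C. card (E `` {x} \<inter> C) < k")
    case True
    then show ?thesis by (intro exI[of _ "\<lambda>_. C"]) auto
  next
    case False
    then obtain v where v: "v \<in> C" "k \<le> card (E `` {v} \<inter> C)" by force
    let ?D = "C - {v}" and ?D' = "C - {v} - E `` {v}"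
    have lt: "card ?D < card C" "card ?D' < card C"
      by (rule psubset_card_mono, use v less.prems in auto)+
    obtain f where f: "\<And>F. f F \<subseteq> ?D \<and> (\<forall>x\<in>f F. card (E `` {x} \<inter> f F) < k)"
      "\<And>I. I \<subseteq> ?D \<Longrightarrow> E \<inter> I \<times> I = {} \<Longrightarrow> \<exists>F\<subseteq>I. card F * k \<le> card ?D \<and> I \<subseteq> F \<union> f F"
      using less.hyps[OF lt(1)] less.prems by auto
    obtain g where g: "\<And>F. g F \<subseteq> ?D' \<and> (\<forall>x\<in>g F. card (E `` {x} \<inter> g F) < k)"
      "\<And>I. I \<subseteq> ?D' \<Longrightarrow> E \<inter> I \<times> I = {} \<Longrightarrow> \<exists>F\<subseteq>I. card F * k \<le> card ?D' \<and> I \<subseteq> F \<union> g F"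
      using less.hyps[OF lt(2)] less.prems by auto
    \<comment> \<open>Decoding: membership of \<open>v\<close> in the fingerprint tells which branch
      was taken.\<close>
    let ?h = "\<lambda>F. if v \<in> F then g (F - {v}) else f F"
    have "\<exists>F\<subseteq>I. card F * k \<le> card C \<and> I \<subseteq> F \<union> ?h F" if I: "I \<subseteq> C" "E \<inter> I \<times> I = {}" for I
    proof (cases "v \<in> I")
      case True
      have "I - {v} \<subseteq> ?D'" "E \<inter> (I - {v}) \<times> (I - {v}) = {}" using I True by auto
      from g(2)[OF this] obtain F where F: "F \<subseteq> I - {v}" "card F * k \<le> card ?D'" "I - {v} \<subseteq> F \<union> g F"
        by auto
      have fin: "finite F" using F(1) I(1) less.prems by (meson finite_Diff finite_subset)
      have nv: "v \<notin> F" using F(1) by auto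
      have "E `` {v} \<inter> C \<subseteq> C" "v \<notin> E `` {v}" using True I by auto
      \<comment> \<open>The at least \<open>k\<close> neighbours deleted along with \<open>v\<close>
        pay for recording \<open>v\<close>.\<close>
      then have "card ?D' + card (E `` {v} \<inter> C) \<le> card C"
        using less.prems by (subst card_Un_disjoint[symmetric]) (auto intro!: card_mono)
      then have "card (insert v F) * k \<le> card C"
        using F(2) v(2) fin nv by simp
      moreover have "I \<subseteq> insert v F \<union> ?h (insert v F)" using F(3) nv by auto
      moreover have "insert v F \<subseteq> I" using F(1) True by auto
      ultimately show ?thesis by blast
    next
      case False
      then have "I \<subseteq> ?D" using I by auto
      from f(2)[OF this I(2)] obtain F where F: "F \<subseteq> I" "card F * k \<le> card ?D" "I \<subseteq> F \<union> f F"
        by auto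
      moreover have "v \<notin> F" using F(1) False by auto
      ultimately show ?thesis using lt(1) by (intro exI[of _ F]) auto
    qed
    moreover have "?h F \<subseteq> C \<and> (\<forall>x\<in>?h F. card (E `` {x} \<inter> ?h F) < k)" for F
      using f(1)[of F] g(1)[of "F - {v}"] by auto
    ultimately show ?thesis by (intro exI[of _ ?h]) blast
  qed
qed

text \<open>Greedy choice of edges: an independent set meets a chosen edge in one of three ways
  instead of four, so each edge gains a factor 3/4. Only the matched vertices \<open>M\<close> are
  kept, as a vertex cover of size \<open>2 * m\<close>.\<close>

lemma maximal_matching_count:
  fixes E :: "('a \<times> 'a) set"
  assumes "finite C" "sym E" "irrefl E"
  shows "\<exists>m M. M \<subseteq> C \<and> card M = 2 * m \<and> E \<inter> (C - M) \<times> (C - M) = {} \<and>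
    card {I. I \<subseteq> C \<and> E \<inter> I \<times> I = {}} * 4 ^ m \<le> 3 ^ m * 2 ^ card C"
  using assms(1)
proof (induction "card C" arbitrary: C rule: less_induct)
  case less
  show ?case
  proof (cases "E \<inter> C \<times> C = {}")
    case True
    have "card {I. I \<subseteq> C \<and> E \<inter> I \<times> I = {}} \<le> card (Pow C)"
      by (rule card_mono) (use less.prems in auto)
    then show ?thesis using True less.prems
      by (intro exI[of _ 0] exI[of _ "{}"]) (auto simp: card_Pow)
  next
    case False
    then obtain x y where xy: "(x, y) \<in> E" "x \<in> C" "y \<in> C" by auto
    have ne: "x \<noteq> y" using xy(1) assms(3) by (auto simp: irrefl_def)
    let ?D = "C - {x, y}"
    have cC: "card C = card ?D + 2"
      using xy ne less.prems card_Diff_subset[of "{x, y}" C] card_mono[of C "{x, y}"] by auto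
    then obtain m M where M: "M \<subseteq> ?D" "card M = 2 * m" "E \<inter> (?D - M) \<times> (?D - M) = {}"
      "card {I. I \<subseteq> ?D \<and> E \<inter> I \<times> I = {}} * 4 ^ m \<le> 3 ^ m * 2 ^ card ?D"
      using less.hyps[of ?D] less.prems by auto
    let ?P = "\<lambda>C. {I. I \<subseteq> C \<and> E \<inter> I \<times> I = {}}"
    have "?P C \<subseteq> (\<lambda>(J, I). J \<union> I) ` ({{}, {x}, {y}} \<times> ?P ?D)"
    proof
      fix I assume I: "I \<in> ?P C"
      then have "I \<inter> {x, y} \<in> {{}, {x}, {y}}" using xy(1) by auto
      moreover have "I - {x, y} \<in> ?P ?D" using I by auto
      moreover have "I = (I \<inter> {x, y}) \<union> (I - {x, y})" by auto
      ultimately show "I \<in> (\<lambda>(J, I). J \<union> I) ` ({{}, {x}, {y}} \<times> ?P ?D)"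
        by (intro image_eqI[where x = "(I \<inter> {x, y}, I - {x, y})"]) auto
    qed
    moreover have fin: "finite (?P ?D)" using less.prems by auto
    ultimately have "card (?P C) \<le> card ({{}, {x}, {y}} \<times> ?P ?D)"
      by (intro surj_card_le) auto
    also have "\<dots> = 3 * card (?P ?D)"
      using ne by (simp add: card_cartesian_product)
    finally have "card (?P C) * 4 ^ Suc m \<le> 3 * card (?P ?D) * 4 ^ Suc m"
      by (rule mult_le_mono1)
    also have "\<dots> = 12 * (card (?P ?D) * 4 ^ m)" by simp
    also have "\<dots> \<le> 12 * (3 ^ m * 2 ^ card ?D)" by (rule mult_le_mono2) (rule M(4))
    also have "\<dots> = 3 ^ Suc m * 2 ^ card C" by (simp add: cC)
    finally have "card (?P C) * 4 ^ Suc m \<le> 3 ^ Suc m * 2 ^ card C" .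
    moreover have "insert x (insert y M) \<subseteq> C" using M(1) xy by auto
    moreover have "card (insert x (insert y M)) = 2 * Suc m"
    proof -
      have "finite M" using M(1) less.prems by (meson finite_Diff finite_subset)
      then show ?thesis using M(1,2) ne by (auto simp: card_insert_if)
    qed
    moreover have "C - insert x (insert y M) = ?D - M" by auto
    ultimately show ?thesis using M(3)
      by (intro exI[of _ "Suc m"] exI[of _ "insert x (insert y M)"]) simp
  qed
qed

text \<open>There are \<open>d * card (C \<inter> Y)\<close> edges at \<open>C \<inter> Y\<close>; those that end in \<open>C\<close> have an endpoint in the
  vertex cover \<open>M\<close>, the others end in \<open>X - C\<close>, whose vertices have degree \<open>d\<close>.\<close>

lemma regular_bipartite_cover_bound:
  fixes E :: "('a \<times> 'a) set"
  assumes fin: "finite X" "finite Y" and E: "sym E" and disj: "X \<inter> Y = {}"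
    and reg: "\<And>x. x \<in> X \<Longrightarrow> E `` {x} \<subseteq> Y \<and> card (E `` {x}) = d"
      "\<And>y. y \<in> Y \<Longrightarrow> E `` {y} \<subseteq> X \<and> card (E `` {y}) = d"
    and C: "C \<subseteq> X \<union> Y" "\<And>x. x \<in> C \<Longrightarrow> card (E `` {x} \<inter> C) \<le> k"
    and M: "M \<subseteq> C" "E \<inter> (C - M) \<times> (C - M) = {}"
  shows "d * card C \<le> d * card X + card M * k"
proof -
  let ?S = "C \<inter> X" and ?T = "C \<inter> Y"
  have finC: "finite C" using C fin finite_subset by blast
  have finE: "x \<in> X \<Longrightarrow> finite (E `` {x})" "y \<in> Y \<Longrightarrow> finite (E `` {y})" for x y
    using reg fin finite_subset by metis+
  have "E \<inter> ?T \<times> X \<subseteq> (E \<inter> ?T \<times> ?S) \<union> (E \<inter> ?T \<times> (X - ?S))" by auto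
  moreover have "E \<inter> ?T \<times> X = Sigma ?T (\<lambda>y. E `` {y})"
    using reg(2) by auto
  moreover have "card (Sigma ?T (\<lambda>y. E `` {y})) = card ?T * d"
    using fin finE reg(2) by (subst card_SigmaI) auto
  moreover have "card ((E \<inter> ?T \<times> ?S) \<union> (E \<inter> ?T \<times> (X - ?S)))
      \<le> card (E \<inter> ?T \<times> ?S) + card (E \<inter> ?T \<times> (X - ?S))"
    by (rule card_Un_le)
  ultimately have 1: "card ?T * d \<le> card (E \<inter> ?T \<times> ?S) + card (E \<inter> ?T \<times> (X - ?S))"
    using fin card_mono[of "(E \<inter> ?T \<times> ?S) \<union> (E \<inter> ?T \<times> (X - ?S))" "E \<inter> ?T \<times> X"]
    by simp
  have "E \<inter> ?T \<times> (X - ?S) \<subseteq> prod.swap ` Sigma (X - ?S) (\<lambda>x. E `` {x})"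
    using E by (auto simp: sym_def image_iff)
  then have "card (E \<inter> ?T \<times> (X - ?S)) \<le> card (Sigma (X - ?S) (\<lambda>x. E `` {x}))"
    using fin finE by (intro surj_card_le) auto
  also have "\<dots> = (\<Sum>x\<in>X - ?S. d)"
    using fin finE reg(1) by (subst card_SigmaI) auto
  also have "\<dots> = (card X - card ?S) * d"
    using fin by (subst card_Diff_subset[symmetric]) auto
  finally have 2: "card (E \<inter> ?T \<times> (X - ?S)) \<le> (card X - card ?S) * d" .
  \<comment> \<open>Each edge inside \<open>C\<close> is charged to an endpoint in \<open>M\<close>;
    the map turns the pair around if that endpoint lies in \<open>X\<close>.\<close>
  have "E \<inter> ?T \<times> ?S \<subseteq> (\<lambda>(x, y). if x \<in> Y then (x, y) else (y, x)) ` Sigma M (\<lambda>x. E `` {x} \<inter> C)"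
  proof
    fix e assume e: "e \<in> E \<inter> ?T \<times> ?S"
    then obtain y x where yx: "e = (y, x)" "(y, x) \<in> E" "(x, y) \<in> E" "y \<in> ?T" "x \<in> ?S"
      using E by (auto simp: sym_def)
    then have "x \<notin> Y" using disj by auto
    from yx M(2) have "y \<in> M \<or> x \<in> M" by auto
    then show "e \<in> (\<lambda>(x, y). if x \<in> Y then (x, y) else (y, x)) ` Sigma M (\<lambda>x. E `` {x} \<inter> C)"
    proof
      assume "y \<in> M"
      then show ?thesis using yx by (intro image_eqI[of _ _ "(y, x)"]) auto
    next
      assume "x \<in> M"
      then show ?thesis using yx \<open>x \<notin> Y\<close> by (intro image_eqI[of _ _ "(x, y)"]) auto
    qed
  qed
  then have "card (E \<inter> ?T \<times> ?S) \<le> card (Sigma M (\<lambda>x. E `` {x} \<inter> C))"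
    using finC finite_subset[OF M(1) finC] by (intro surj_card_le) auto
  also have "\<dots> = (\<Sum>x\<in>M. card (E `` {x} \<inter> C))"
    using finC finite_subset[OF M(1) finC] by (subst card_SigmaI) auto
  also have "\<dots> \<le> (\<Sum>x\<in>M. k)"
    using C(2) M(1) by (intro sum_mono) auto
  finally have 3: "card (E \<inter> ?T \<times> ?S) \<le> card M * k" by simp
  have "C = ?S \<union> ?T" using C(1) by auto
  then have "card C = card ?S + card ?T"
    using finC disj card_Un_disjoint[of ?S ?T] by auto
  moreover have "card ?S \<le> card X" using fin by (intro card_mono) auto
  then have "(card X - card ?S) * d + card ?S * d = d * card X"
    by (metis add_mult_distrib le_add_diff_inverse2 mult.commute)
  ultimately show ?thesis using 1 2 3 by (simp add: algebra_simps)
qed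

subsection \<open>The upper bound\<close>

lemma sum_power_card_Pow:
  "finite V \<Longrightarrow> (\<Sum>F\<in>Pow V. x ^ card F) = (1 + x :: real) ^ card V"
proof (induction V rule: finite_induct)
  case (insert v V)
  have "inj_on (insert v) (Pow V)" using insert.hyps by (auto simp: inj_on_def)
  moreover have "card (insert v F) = Suc (card F)" if "F \<in> Pow V" for F
    using that insert.hyps by (subst card_insert_disjoint) (auto intro: finite_subset)
  ultimately have "(\<Sum>F\<in>insert v ` Pow V. x ^ card F) = (\<Sum>F\<in>Pow V. x * x ^ card F)"
    by (simp add: sum.reindex)
  moreover have "Pow V \<inter> insert v ` Pow V = {}" using insert.hyps by auto
  ultimately show ?case
    using insert by (simp add: Pow_insert sum.union_disjoint sum_distrib_left[symmetric] algebra_simps)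
qed simp

text \<open>Exponential Markov bound: every set counted has weight \<open>x ^ card F\<close> at
  least \<open>x powr q\<close>, and all subsets together weigh
  \<open>(1 + x) ^ card V\<close>.\<close>

lemma card_small_subsets_le:
  assumes "finite V" "0 < x" "x \<le> 1"
  shows "real (card {F. F \<subseteq> V \<and> real (card F) \<le> q}) \<le> (1 + x) ^ card V * x powr - q"
proof -
  have "(\<Sum>F\<in>{F. F \<subseteq> V \<and> real (card F) \<le> q}. x powr q) \<le>
      (\<Sum>F\<in>{F. F \<subseteq> V \<and> real (card F) \<le> q}. x ^ card F)"
    using assms by (intro sum_mono) (simp add: powr_realpow[symmetric] powr_mono')
  also have "\<dots> \<le> (\<Sum>F\<in>Pow V. x ^ card F)"
    using assms by (intro sum_mono2) auto
  also have "\<dots> = (1 + x) ^ card V" using assms by (simp add: sum_power_card_Pow)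
  finally show ?thesis using assms by (simp add: powr_minus field_simps)
qed

lemma one_add_le_two_powr:
  fixes x :: real
  assumes "0 \<le> x"
  shows "1 + x \<le> 2 powr (2 * x)"
proof -
  have "ln (exp (1 / 2)) \<le> ln (2 :: real)" by (subst ln_le_cancel_iff) (auto simp: exp_half_le2)
  then have "x \<le> 2 * x * ln 2" using assms mult_left_mono[of "1 / 2" "ln 2" "2 * x"] by simp
  moreover have "1 + x \<le> exp x" by (rule exp_ge_add_one_self)
  ultimately have "1 + x \<le> exp (2 * x * ln 2)" by (meson exp_le_cancel_iff order.trans)
  then show ?thesis by (simp add: powr_def)
qed

text \<open>The same bound in bits. The parameter \<open>x\<close> stays free: 1/16 serves for small
  balanced sets, 1/d for fingerprints.\<close>

lemma card_small_subsets_le_two_powr: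
  assumes "finite V" "0 < x" "x \<le> 1"
  shows "real (card {F. F \<subseteq> V \<and> real (card F) \<le> q})
    \<le> 2 powr (2 * x * real (card V) + q * log 2 (1 / x))"
proof -
  have "(1 + x) ^ card V \<le> (2 powr (2 * x)) ^ card V"
    using assms by (intro power_mono one_add_le_two_powr) auto
  also have "\<dots> = 2 powr (2 * x * real (card V))"
    by (simp add: powr_powr flip: powr_realpow)
  finally have 1: "(1 + x) ^ card V \<le> 2 powr (2 * x * real (card V))" .
  have "x powr - q = (2 powr log 2 (1 / x)) powr q"
    using assms by (simp add: powr_minus powr_divide inverse_eq_divide)
  also have "\<dots> = 2 powr (q * log 2 (1 / x))"
    by (simp only: powr_powr mult.commute)
  finally have 2: "x powr - q = 2 powr (q * log 2 (1 / x))" .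
  have "(1 + x) ^ card V * x powr - q \<le> 2 powr (2 * x * real (card V) + q * log 2 (1 / x))"
    unfolding 2 powr_add using 1 by (intro mult_right_mono) auto
  then show ?thesis using card_small_subsets_le[OF assms, of q] by linarith
qed

text \<open>Follows from (3/4)^5 = 243/1024 < 1/4. The saving 2m/5 is twice the excess m/5 that a
  container may have over half the cube.\<close>

lemma three_quarters_power: "(3 / 4 :: real) ^ m \<le> 2 powr (- (2 * real m / 5))"
proof -
  have p: "(2 powr y) ^ k = 2 powr (y * real k)" for y :: real and k
    by (simp add: powr_powr flip: powr_realpow)
  have "((3 / 4 :: real) ^ m) ^ 5 = ((3 / 4) ^ 5) ^ m" by (simp flip: power_mult add: mult.commute)
  also have "\<dots> \<le> (1 / 4) ^ m" by (intro power_mono) (auto simp: power_divide)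
  also have "1 / 4 = (2 :: real) powr (- 2)" by (simp add: powr_minus)
  also have "(2 powr (- 2)) ^ m = (2 powr (- (2 * real m / 5))) ^ 5" unfolding p by simp
  finally show ?thesis by (rule power_mono_iff[THEN iffD1, rotated 3]) auto
qed

section \<open>The two parity classes and expansion between them\<close>

lemma finite_even_vertices: "finite (even_vertices d)"
  and finite_odd_vertices: "finite (odd_vertices d)"
  by (auto simp: even_vertices_eq odd_vertices_eq finite_binary_strings)

lemma card_even_vertices: "card (even_vertices (Suc m)) = 2 ^ m"
  using bij_betw_same_card[OF bij_betw_tl_even] by (simp add: card_binary_strings)

lemma card_odd_vertices: "card (odd_vertices (Suc m)) = 2 ^ m"
  using bij_betw_same_card[OF bij_betw_tl_odd] by (simp add: card_binary_strings)

lemma even_odd_disjoint: "even_vertices d \<inter> odd_vertices d = {}"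
  by (auto simp: even_vertices_eq odd_vertices_eq)

lemma even_un_odd: "even_vertices d \<union> odd_vertices d = binary_strings d"
  by (auto simp: even_vertices_eq odd_vertices_eq)

lemma neighbours_hypercube:
  "x \<in> binary_strings d \<Longrightarrow> parcs (hypercube d) `` {x} = flips x"
  by (auto simp: parcs_hypercube binary_strings_def)

lemma neighbours_even:
  assumes "x \<in> even_vertices d"
  shows "parcs (hypercube d) `` {x} \<subseteq> odd_vertices d \<and> card (parcs (hypercube d) `` {x}) = d"
  using assms flips_subset[of x d] parity_flips[of _ x]
  by (auto simp: even_vertices_eq odd_vertices_eq neighbours_hypercube card_flips binary_strings_def)

lemma neighbours_odd:
  assumes "x \<in> odd_vertices d"
  shows "parcs (hypercube d) `` {x} \<subseteq> even_vertices d \<and> card (parcs (hypercube d) `` {x}) = d"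
  using assms flips_subset[of x d] parity_flips[of _ x]
  by (auto simp: even_vertices_eq odd_vertices_eq neighbours_hypercube card_flips binary_strings_def)

text \<open>Once first letters are deleted, flipping the first letter fixes a point and flipping
  another one moves it to a neighbour. So the image of the neighbourhood of \<open>S\<close>
  contains the closed neighbourhood of the image of \<open>S\<close>, and vertex isoperimetry in
  dimension \<open>m\<close> applies.\<close>

lemma even_neighbourhood_ge:
  assumes S: "S \<subseteq> even_vertices (Suc m)" and "m > 0"
  shows "real (card S) * (2 ^ m - real (card S)) / (2 ^ m * sqrt (real m))
    \<le> real (card (parcs (hypercube (Suc m)) `` S)) - real (card S)"
proof -
  let ?E = "parcs (hypercube (Suc m))"
  have "inj_on tl S"
    using bij_betw_tl_even S by (meson bij_betw_def inj_on_subset)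
  then have c: "card (tl ` S) = card S" by (rule card_image)
  have "tl ` S \<subseteq> binary_strings m"
    using bij_betw_imp_surj_on[OF bij_betw_tl_even, of m] S by auto
  note v = vertex_boundary_ge[OF this \<open>m > 0\<close>, unfolded c]
  have "(\<Union>x\<in>tl ` S. insert x (flips x)) \<subseteq> tl ` (?E `` S)"
  proof
    fix y assume "y \<in> (\<Union>x\<in>tl ` S. insert x (flips x))"
    then obtain x where x: "x \<in> S" "y = tl x \<or> y \<in> flips (tl x)" by auto
    from x(1) S have "length x = Suc m" by (auto simp: even_vertices_eq binary_strings_def)
    then obtain b z where z: "x = b # z" "length z = m" by (metis length_Suc_conv)
    show "y \<in> tl ` (?E `` S)"
    proof (cases "y = tl x")
      case True
      then have "((b # z), (\<not> b) # z) \<in> ?E" "y = tl ((\<not> b) # z)" using z by (auto simp: parcs_hypercube)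
      then show ?thesis using x(1) z by blast
    next
      case False
      then have "((b # z), b # y) \<in> ?E" "y = tl (b # y)" using z x by (auto simp: parcs_hypercube)
      then show ?thesis using x(1) z by blast
    qed
  qed
  moreover have "finite (?E `` S)"
    by (rule finite_subset[OF _ finite_binary_strings[of "Suc m"]])
       (auto simp: parcs_hypercube binary_strings_def length_flips)
  ultimately have "card (\<Union>x\<in>tl ` S. insert x (flips x)) \<le> card (?E `` S)"
    by (intro surj_card_le)
  then show ?thesis using v by linarith
qed

lemma independent_sets_in_sparse_container:
  assumes C: "C \<subseteq> binary_strings (Suc m)"
    and deg: "\<And>x. x \<in> C \<Longrightarrow> card (parcs (hypercube (Suc m)) `` {x} \<inter> C) \<le> k"
    and k: "10 * k \<le> Suc m" and m: "m > 0"
    and CX: "2 ^ m / 128 \<le> real (card (C \<inter> even_vertices (Suc m)))"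
    and CY: "2 ^ m / 128 \<le> real (card (C \<inter> odd_vertices (Suc m)))"
  shows "real (card {I. I \<subseteq> C \<and> parcs (hypercube (Suc m)) \<inter> I \<times> I = {}})
    \<le> 2 powr (2 ^ m - 2 ^ m / (1310720 * sqrt (real m)))"
proof -
  define E where "E = parcs (hypercube (Suc m))"
  define X where "X = even_vertices (Suc m)"
  define Y where "Y = odd_vertices (Suc m)"
  define n :: real where "n = 2 ^ m"
  \<comment> \<open>65536 is 256 squared: isoperimetry is used for a set that has at least n/256
    points and misses at least n/256 points.\<close>
  define \<theta> where "\<theta> = 1 / (65536 * sqrt (real m))"
  define cnt where "cnt = card {I. I \<subseteq> C \<and> E \<inter> I \<times> I = {}}"
  have n: "n > 0" by (simp add: n_def)
  have \<theta>: "0 < \<theta>" "\<theta> \<le> 1 / 65536" using m by (auto simp: \<theta>_def field_simps)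
  have fin: "finite X" "finite Y" by (simp_all add: X_def Y_def finite_even_vertices finite_odd_vertices)
  have finC: "finite C" using C finite_binary_strings finite_subset by blast
  have cX: "real (card X) = n" and cY: "real (card Y) = n"
    by (simp_all add: X_def Y_def n_def card_even_vertices card_odd_vertices)
  have "irrefl E" "sym E"
    using not_in_flips_self sym_parcs_hypercube by (auto simp: E_def irrefl_def parcs_hypercube)
  from maximal_matching_count[OF finC this(2,1)] obtain j M where M: "M \<subseteq> C" "card M = 2 * j"
    "E \<inter> (C - M) \<times> (C - M) = {}" and cnt: "cnt * 4 ^ j \<le> 3 ^ j * 2 ^ card C"
    unfolding cnt_def by blast
  have finM: "finite M" using M(1) finC finite_subset by blast
  have cnt': "real cnt \<le> (3 / 4) ^ j * 2 powr real (card C)"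
  proof -
    have "real (cnt * 4 ^ j) \<le> real (3 ^ j * 2 ^ card C)" using cnt by (subst of_nat_le_iff)
    then show ?thesis by (simp add: powr_realpow field_simps)
  qed
  \<comment> \<open>Maximality makes \<open>M\<close> a vertex cover of \<open>C\<close>; with
    \<open>10 * k \<le> Suc m\<close> its \<open>2 * j\<close> vertices account for an excess of at
    most j/5.\<close>
  have "Suc m * card C \<le> Suc m * card X + card M * k"
    by (rule regular_bipartite_cover_bound[where E = E and Y = Y])
      (use fin \<open>sym E\<close> even_odd_disjoint neighbours_even neighbours_odd C deg M even_un_odd in
        \<open>auto simp: E_def X_def Y_def\<close>)
  then have "10 * (Suc m * card C) \<le> 10 * (Suc m * card X) + card M * (10 * k)" by simp
  also have "\<dots> \<le> 10 * (Suc m * card X) + card M * Suc m" using k by (intro add_mono mult_le_mono) auto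
  finally have "Suc m * (10 * card C) \<le> Suc m * (10 * card X + 2 * j)"
    by (simp add: M(2) algebra_simps)
  then have "10 * card C \<le> 10 * card X + 2 * j" by (subst (asm) mult_le_cancel1) simp
  then have "real (10 * card C) \<le> real (10 * card X + 2 * j)" by (subst of_nat_le_iff)
  then have cC: "real (card C) \<le> n + real j / 5" using cX by simp
  have "real cnt \<le> 2 powr (n - \<theta> * n / 20)"
  \<comment> \<open>A long matching saves 2j/5 bits against an excess of j/5, a net gain of at least
    \<theta>n/20. With a short one, \<open>M\<close> has fewer than \<theta>n/2 vertices, too few to
    cancel the isoperimetric gain \<theta>n.\<close>
  proof (cases "\<theta> * n \<le> 4 * real j")
    case True
    have "(3 / 4) ^ j * 2 powr real (card C) \<le> 2 powr (- (2 * real j / 5)) * 2 powr (n + real j / 5)"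
      using cC by (intro mult_mono three_quarters_power powr_mono) auto
    with cnt' have "real cnt \<le> 2 powr (- (2 * real j / 5)) * 2 powr (n + real j / 5)" by linarith
    also have "\<dots> = 2 powr (- (2 * real j / 5) + (n + real j / 5))" by (simp only: powr_add)
    also have "- (2 * real j / 5) + (n + real j / 5) = n - real j / 5" by simp
    also have "2 powr (n - real j / 5) \<le> 2 powr (n - \<theta> * n / 20)" using True by (intro powr_mono) auto
    finally show ?thesis .
  next
    case False
    let ?S = "(C - M) \<inter> X" and ?T = "(C - M) \<inter> Y"
    have \<theta>n: "\<theta> * n \<le> n / 65536" using mult_right_mono[OF \<theta>(2), of n] n by simp
    have "card (C \<inter> Z) \<le> card M + card ((C - M) \<inter> Z)" for Z
      using finM finC by (intro order.trans[OF card_mono card_Un_le]) auto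
    then have *: "real (card (C \<inter> Z)) \<le> 2 * real j + real (card ((C - M) \<inter> Z))" for Z
      using M(2) of_nat_mono[of "card (C \<inter> Z)" "card M + card ((C - M) \<inter> Z)", where 'a = real] by simp
    have S: "n / 256 \<le> real (card ?S)" and T: "n / 256 \<le> real (card ?T)"
      using *[of X] *[of Y] CX[folded X_def n_def] CY[folded Y_def n_def] False \<theta>n by linarith+
    have iso: "real (card ?S) * (n - real (card ?S)) / (n * sqrt (real m)) \<le> real (card (E `` ?S)) - real (card ?S)"
      unfolding n_def E_def by (rule even_neighbourhood_ge) (use m in \<open>auto simp: X_def\<close>)
    have "E `` ?S \<subseteq> Y" using neighbours_even[of _ "Suc m"] by (auto simp: E_def X_def Y_def)
    then have "E `` ?S \<subseteq> Y - ?T" using M(3) by auto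
    then have "card (E `` ?S) \<le> card (Y - ?T)" using fin by (intro card_mono) auto
    moreover have "card (Y - ?T) + card ?T = card Y"
      using fin by (subst card_Un_disjoint[symmetric]) (auto intro: arg_cong[where f = card])
    ultimately have ET: "real (card (E `` ?S)) + real (card ?T) \<le> n" using cY by linarith
    have "card ?S \<le> card X" using fin by (intro card_mono) auto
    then have "real (card ?S) \<le> n" using cX by linarith
    then have "0 \<le> real (card ?S) * (n - real (card ?S)) / (n * sqrt (real m))" using n by auto
    then have "real (card ?T) \<le> n - real (card ?S)" using iso ET by linarith
    then have "n / 256 * (n / 256) \<le> real (card ?S) * (n - real (card ?S))"
      using S T n by (intro mult_mono) auto
    then have "n / 256 * (n / 256) / (n * sqrt (real m)) \<le> real (card ?S) * (n - real (card ?S)) / (n * sqrt (real m))"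
      using n by (intro divide_right_mono) auto
    moreover have "n / 256 * (n / 256) / (n * sqrt (real m)) = \<theta> * n"
      using n by (simp add: \<theta>_def field_simps)
    ultimately have ST: "real (card ?S) + real (card ?T) \<le> n - \<theta> * n" using iso ET by linarith
    have "C \<subseteq> M \<union> (?S \<union> ?T)" using C even_un_odd by (auto simp: X_def Y_def)
    then have "card C \<le> card (M \<union> (?S \<union> ?T))" using finM finC by (intro card_mono) auto
    also have "\<dots> \<le> card M + (card ?S + card ?T)"
      by (meson add_left_mono card_Un_le order.trans)
    finally have "real (card C) \<le> 2 * real j + (real (card ?S) + real (card ?T))" using M(2) by simp
    then have "real (card C) \<le> n - \<theta> * n / 20" using ST False \<theta> n mult_pos_pos[of \<theta> n] by linarith
    then have "2 powr real (card C) \<le> 2 powr (n - \<theta> * n / 20)" by (intro powr_mono) auto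
    moreover have "(3 / 4) ^ j * 2 powr real (card C) \<le> 1 * 2 powr real (card C)"
      by (intro mult_right_mono power_le_one) auto
    ultimately show ?thesis using cnt' by linarith
  qed
  then show ?thesis by (simp add: cnt_def E_def n_def \<theta>_def mult_ac)
qed

text \<open>The first term counts small sets; the second is the number of fingerprints times the
  bound per container. The threshold 2560 = 20 * 128 makes fingerprints have at most n/128 elements,
  where n is half the number of vertices.\<close>

lemma bis_upper:
  assumes m: "m \<ge> 2560"
  shows "real (bis (Suc m)) \<le> 2 powr (3 / 8 * 2 ^ m) +
    2 powr (2 ^ m * (1 + 20 * log 2 (real (Suc m)) / real (Suc m) + 4 / real (Suc m) - 1 / (1310720 * sqrt (real m))))"
proof -
  define d where "d = Suc m"
  define E where "E = parcs (hypercube d)"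
  define X where "X = even_vertices d"
  define Y where "Y = odd_vertices d"
  define V where "V = binary_strings d"
  define n :: real where "n = 2 ^ m"
  define q where "q = 20 * n / real d"
  define B where "B = 2 powr (2 ^ m - 2 ^ m / (1310720 * sqrt (real m)))"
  define indep where "indep = (\<lambda>I. E \<inter> I \<times> I = {})"
  have n: "n > 0" by (simp add: n_def)
  have finV: "finite V" by (simp add: V_def finite_binary_strings)
  have cV: "card V = 2 ^ d" "real (card V) = 2 * n" by (simp_all add: V_def card_binary_strings n_def d_def)
  have XY: "X \<union> Y = V" "X \<inter> Y = {}" by (simp_all add: X_def Y_def V_def even_un_odd even_odd_disjoint)
  have q: "q \<le> n / 128" unfolding q_def d_def using m n by (simp add: field_simps)
  let ?small = "{I. I \<subseteq> V \<and> real (card I) \<le> n / 32}"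
  let ?large = "{I. I \<subseteq> V \<and> indep I \<and> n / 64 \<le> real (card (I \<inter> X)) \<and> n / 64 \<le> real (card (I \<inter> Y))}"
  have split: "{I. independent_set (hypercube d) I \<and> balanced d I} \<subseteq> ?small \<union> ?large"
  proof
    fix I assume "I \<in> {I. independent_set (hypercube d) I \<and> balanced d I}"
    then have sub: "I \<subseteq> V" and ind: "indep I" and bal: "card (I \<inter> X) = card (I \<inter> Y)"
      by (auto simp: independent_set_def V_def pverts_hypercube indep_def E_def balanced_def X_def Y_def)
    have "finite I" using sub finV finite_subset by blast
    then have "card (I \<inter> X) + card (I \<inter> Y) = card ((I \<inter> X) \<union> (I \<inter> Y))"
      using XY(2) by (intro card_Un_disjoint[symmetric]) auto
    also have "(I \<inter> X) \<union> (I \<inter> Y) = I" using sub XY(1) by auto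
    finally have "card I = 2 * card (I \<inter> X)" using bal by simp
    then show "I \<in> ?small \<union> ?large"
      using sub ind bal by (cases "n / 64 \<le> real (card (I \<inter> X))") auto
  qed
  have small: "real (card ?small) \<le> 2 powr (3 / 8 * n)"
  proof -
    have "log 2 (2 powr 4 :: real) = 4" by (rule log_powr_cancel) auto
    then have "log 2 (16 :: real) = 4" by simp
    \<comment> \<open>With x = 1/16 and 2n vertices the exponent is n/4 + 4 * n/32 = 3n/8.\<close>
    then show ?thesis
      using card_small_subsets_le_two_powr[OF finV, of "1 / 16" "n / 32"] cV by simp
  qed
  \<comment> \<open>This \<open>k\<close> exceeds d/10, so fingerprints have at most 10 * 2n/d =
    \<open>q\<close> elements, while degrees inside containers stay at most
    \<open>d div 10\<close>.\<close>
  obtain f where f: "\<And>F. f F \<subseteq> V" "\<And>F x. x \<in> f F \<Longrightarrow> card (E `` {x} \<inter> f F) < d div 10 + 1"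
    "\<And>I. I \<subseteq> V \<Longrightarrow> indep I \<Longrightarrow> \<exists>F\<subseteq>I. card F * (d div 10 + 1) \<le> card V \<and> I \<subseteq> F \<union> f F"
    using graph_container[OF finV, of E "d div 10 + 1"] unfolding indep_def by metis
  let ?fp = "{F. F \<subseteq> V \<and> real (card F) \<le> q}"
  let ?ext = "\<lambda>F. {I \<in> ?large. F \<subseteq> I \<and> I \<subseteq> F \<union> f F}"
  have large_sub: "?large \<subseteq> (\<Union>F\<in>?fp. ?ext F)"
  proof
    fix I assume I: "I \<in> ?large"
    then obtain F where F: "F \<subseteq> I" "card F * (d div 10 + 1) \<le> card V" "I \<subseteq> F \<union> f F"
      using f(3)[of I] by auto
    have "card F * d \<le> card F * (10 * (d div 10 + 1))" by (intro mult_le_mono) auto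
    also have "\<dots> \<le> 10 * card V" using mult_le_mono2[OF F(2), of 10] by (simp only: mult_ac)
    finally have "real (card F * d) \<le> real (10 * card V)" by (subst of_nat_le_iff)
    then have "real (card F) \<le> q" using cV by (simp add: q_def d_def field_simps)
    then show "I \<in> (\<Union>F\<in>?fp. ?ext F)" using I F by auto
  qed
  have ext: "real (card (?ext F)) \<le> B" if F: "F \<in> ?fp" for F
  proof (cases "?ext F = {}")
    case True
    then show ?thesis by (simp only: card.empty) (simp add: B_def)
  next
    case False
    then obtain I where I: "I \<in> ?large" "F \<subseteq> I" "I \<subseteq> F \<union> f F" by auto
    have finF: "finite F" using F finV finite_subset by blast
    have "card (I \<inter> Z) \<le> card F + card (f F \<inter> Z)" for Z
      using finF I(3) finite_subset[OF f(1) finV] by (intro order.trans[OF card_mono card_Un_le]) auto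
    then have *: "real (card (I \<inter> Z)) \<le> real (card F) + real (card (f F \<inter> Z))" for Z
      using of_nat_mono[of "card (I \<inter> Z)" "card F + card (f F \<inter> Z)", where 'a = real] by simp
    \<comment> \<open>A single large \<open>I\<close> suffices: it has n/64 points in each class, of
      which the fingerprint takes at most n/128.\<close>
    have cf: "n / 128 \<le> real (card (f F \<inter> X))" "n / 128 \<le> real (card (f F \<inter> Y))"
      using *[of X] *[of Y] I(1) F q by auto
    have "card (?ext F) \<le> card {J. J \<subseteq> f F \<and> indep J}"
    proof (rule card_inj_on_le[where f = "\<lambda>I. I - F"])
      show "inj_on (\<lambda>I. I - F) (?ext F)" by (rule inj_onI) blast
      show "(\<lambda>I. I - F) ` ?ext F \<subseteq> {J. J \<subseteq> f F \<and> indep J}" by (auto simp: indep_def)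
      show "finite {J. J \<subseteq> f F \<and> indep J}" using finite_subset[OF f(1) finV] by simp
    qed
    moreover have "real (card {J. J \<subseteq> f F \<and> indep J}) \<le> B"
      unfolding indep_def E_def B_def d_def
    proof (rule independent_sets_in_sparse_container)
      show "f F \<subseteq> binary_strings (Suc m)" using f(1) by (simp add: V_def d_def)
      show "card (parcs (hypercube (Suc m)) `` {x} \<inter> f F) \<le> d div 10" if "x \<in> f F" for x
        using f(2)[OF that] by (simp add: E_def d_def)
    qed (use cf m in \<open>auto simp: n_def X_def Y_def d_def\<close>)
    ultimately show ?thesis by linarith
  qed
  have fp: "real (card ?fp) \<le> 2 powr (4 * n / real d + q * log 2 (real d))"
    using card_small_subsets_le_two_powr[OF finV, of "1 / real d" q] cV by (simp add: d_def)
  have finfp: "finite ?fp" using finV by simp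
  have "finite (\<Union>F\<in>?fp. ?ext F)"
    by (rule finite_subset[of _ "Pow V"]) (use finV in auto)
  then have "card ?large \<le> card (\<Union>F\<in>?fp. ?ext F)"
    by (rule card_mono[OF _ large_sub])
  also have "\<dots> \<le> (\<Sum>F\<in>?fp. card (?ext F))" by (rule card_UN_le[OF finfp])
  finally have "real (card ?large) \<le> real (\<Sum>F\<in>?fp. card (?ext F))"
    by (subst of_nat_le_iff)
  also have "\<dots> = (\<Sum>F\<in>?fp. real (card (?ext F)))" by (rule of_nat_sum)
  also have "\<dots> \<le> (\<Sum>F\<in>?fp. B)" by (intro sum_mono ext)
  also have "\<dots> = real (card ?fp) * B" by simp
  also have "\<dots> \<le> 2 powr (4 * n / real d + q * log 2 (real d)) * B"
    using fp by (intro mult_right_mono) (auto simp: B_def)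
  also have "\<dots> = 2 powr (n * (1 + 20 * log 2 (real d) / real d + 4 / real d - 1 / (1310720 * sqrt (real m))))"
    by (simp add: B_def q_def n_def algebra_simps flip: powr_add)
  finally have large: "real (card ?large) \<le> \<dots>" .
  have "bis d \<le> card (?small \<union> ?large)"
    unfolding bis_def using split finV by (intro card_mono) auto
  also have "\<dots> \<le> card ?small + card ?large" by (rule card_Un_le)
  finally have "real (bis d) \<le> real (card ?small) + real (card ?large)" by linarith
  then show ?thesis using small large unfolding n_def d_def by linarith
qed

lemma log_bis_upper:
  "\<forall>\<^sub>F m in sequentially. log 2 (real (bis (Suc m))) \<le> (1 - (1 / 5242880) / sqrt (real (Suc m))) * 2 ^ m"
proof -
  \<comment> \<open>The available gain is 4c / sqrt m. About half of it absorbs the fingerprint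
    cost, and a further c absorbs the factor 2 from adding two terms.\<close>
  define c :: real where "c = 1 / 5242880"
  have 1: "\<forall>\<^sub>F m in sequentially. 20 * log 2 (real (Suc m)) / real (Suc m) + 4 / real (Suc m) - 1 / (1310720 * sqrt (real m))
      \<le> - (2 * c) / sqrt (real (Suc m))"
    unfolding c_def by real_asymp
  have 2: "\<forall>\<^sub>F m in sequentially. 3 / 8 \<le> 1 - 2 * c / sqrt (real (Suc m))"
    unfolding c_def by real_asymp
  have 3: "\<forall>\<^sub>F m in sequentially. 1 \<le> 2 ^ m * (c / sqrt (real (Suc m)))"
    unfolding c_def by real_asymp
  show ?thesis
    using 1 2 3 eventually_ge_at_top[of 2560]
  proof eventually_elim
    case (elim m)
    define e where "e = 2 ^ m * (1 - 2 * c / sqrt (real (Suc m)))"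
    have "2 ^ m * (1 + 20 * log 2 (real (Suc m)) / real (Suc m) + 4 / real (Suc m) - 1 / (1310720 * sqrt (real m))) \<le> e"
      unfolding e_def using elim(1) by (intro mult_left_mono) auto
    moreover have "3 / 8 * 2 ^ m \<le> e"
      unfolding e_def using elim(2) by (subst mult.commute, intro mult_left_mono) auto
    ultimately have "real (bis (Suc m)) \<le> 2 powr e + 2 powr e"
      by (intro order.trans[OF bis_upper[OF elim(4)] add_mono] powr_mono) auto
    also have "\<dots> = 2 powr (1 + e)" by (simp add: powr_add)
    finally have b: "real (bis (Suc m)) \<le> 2 powr (1 + e)" .
    have "bis (Suc m) > 0"
      unfolding bis_def using finite_balanced_independent_sets[of "Suc m"]
      by (subst card_gt_0_iff) (auto intro!: exI[of _ "{}"] simp: independent_set_def balanced_def)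
    then have "log 2 (real (bis (Suc m))) \<le> 1 + e"
      using b by (simp add: log_le_iff)
    also have "\<dots> \<le> (1 - c / sqrt (real (Suc m))) * 2 ^ m"
      using elim(3) by (simp add: e_def algebra_simps)
    finally show ?case by (simp add: c_def)
  qed
qed

subsection \<open>The lower bound\<close>

lemma card_weight_layer:
  "card {x \<in> binary_strings m. count_list x True = k} = m choose k"
proof (induction m arbitrary: k)
  case 0
  have "{x \<in> binary_strings 0. count_list x True = k} = (if k = 0 then {[]} else {})"
    by (auto simp: binary_strings_def)
  then show ?case by simp
next
  case (Suc m)
  have "{x \<in> binary_strings (Suc m). count_list x True = k} =
      Cons False ` {x \<in> binary_strings m. count_list x True = k} \<union>
      Cons True ` {x \<in> binary_strings m. Suc (count_list x True) = k}"
    by (auto simp: binary_strings_Suc)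
  then have "card {x \<in> binary_strings (Suc m). count_list x True = k} =
      card {x \<in> binary_strings m. count_list x True = k} +
      card {x \<in> binary_strings m. Suc (count_list x True) = k}"
    by (simp, subst card_Un_disjoint) (auto simp: finite_binary_strings card_image)
  then show ?case using Suc.IH by (cases k) simp_all
qed

text \<open>The factor 2n + 1 makes the induction close: one step multiplies the left side by 4(2n +
  1)(2n + 3)/(n + 1)^2, which is at most 16 because (2n + 1)(2n + 3) \<le> (2n + 2)^2.\<close>

lemma central_binomial_upper: "(real ((2 * n) choose n))\<^sup>2 * (2 * real n + 1) \<le> 16 ^ n"
proof (induction n)
  case (Suc n)
  have "Suc n * ((2 * Suc n) choose Suc n) = 2 * (2 * n + 1) * ((2 * n) choose n)"
  proof -
    have "Suc n * ((2 * Suc n) choose Suc n) = 2 * Suc n * (Suc (2 * n) choose n)"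
      using Suc_times_binomial_eq[of "Suc (2 * n)" n] by simp
    also have "Suc n * (Suc (2 * n) choose n) = Suc (2 * n) * ((2 * n) choose n)"
      using Suc_times_binomial_eq[of "2 * n" n] binomial_symmetric[of n "Suc (2 * n)"]
      by (simp add: mult.commute Suc_diff_le)
    then have "2 * Suc n * (Suc (2 * n) choose n) = 2 * (2 * n + 1) * ((2 * n) choose n)"
      by (simp only: mult.assoc) simp
    finally show ?thesis .
  qed
  then have "real (Suc n * ((2 * Suc n) choose Suc n)) = real (2 * (2 * n + 1) * ((2 * n) choose n))"
    by (simp only:)
  then have "real ((2 * Suc n) choose Suc n) = 2 * (2 * real n + 1) / (real n + 1) * real ((2 * n) choose n)"
    by (simp add: field_simps)
  then have "(real ((2 * Suc n) choose Suc n))\<^sup>2 * (2 * real (Suc n) + 1) =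
      (2 * (2 * real n + 1) / (real n + 1) * real ((2 * n) choose n))\<^sup>2 * (2 * real n + 3)"
    by (simp only:) simp
  also have "\<dots> = (real ((2 * n) choose n))\<^sup>2 * (2 * real n + 1) *
      (4 * (2 * real n + 1) * (2 * real n + 3) / (real n + 1)\<^sup>2)"
    by (simp only: power2_eq_square times_divide_eq_left times_divide_eq_right divide_divide_eq_left mult_ac)
  also have "\<dots> \<le> 16 ^ n * 16"
  proof (intro mult_mono Suc.IH)
    show "4 * (2 * real n + 1) * (2 * real n + 3) / (real n + 1)\<^sup>2 \<le> 16"
      by (subst pos_divide_le_eq) (auto simp: power2_eq_square algebra_simps add_pos_nonneg)
  qed auto
  finally show ?case by simp
qed simp

lemma middle_binomial_upper: "real (m choose (m div 2)) * sqrt (real m) \<le> 2 ^ m"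
proof -
  have even: "real ((2 * n) choose n) * sqrt (2 * real n + 1) \<le> 4 ^ n" for n
  proof (rule power2_le_imp_le)
    have "((4::real) ^ n)\<^sup>2 = 16 ^ n" by (simp add: power2_eq_square flip: power_mult_distrib)
    then show "(real ((2 * n) choose n) * sqrt (2 * real n + 1))\<^sup>2 \<le> (4 ^ n)\<^sup>2"
      using central_binomial_upper[of n] by (simp add: power_mult_distrib)
  qed simp
  show ?thesis
  proof (cases "even m")
    case True
    then obtain n where m: "m = 2 * n" by blast
    have "real ((2 * n) choose n) * sqrt (2 * real n) \<le> real ((2 * n) choose n) * sqrt (2 * real n + 1)"
      by (intro mult_left_mono) auto
    then have "real ((2 * n) choose n) * sqrt (2 * real n) \<le> 4 ^ n" using even[of n] by linarith
    then show ?thesis by (simp add: m power_mult)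
  next
    case False
    then obtain n where m: "m = 2 * n + 1" using oddE by blast
    \<comment> \<open>The odd case reduces to the next even one, whose central coefficient is
      exactly twice as large.\<close>
    have *: "(2 * Suc n) choose Suc n = 2 * ((2 * n + 1) choose n)"
      using central_binomial_odd[of "2 * n + 1"] by (simp add: binomial_symmetric[of n "Suc (2 * n)"] Suc_diff_le)
    have "real ((2 * n + 1) choose n) * sqrt (2 * real n + 1) \<le> real ((2 * n + 1) choose n) * sqrt (2 * real (Suc n) + 1)"
      by (intro mult_left_mono) auto
    then have "2 * (real ((2 * n + 1) choose n) * sqrt (2 * real n + 1)) \<le> 4 ^ Suc n"
      using even[of "Suc n", unfolded * of_nat_mult of_nat_numeral mult.assoc] by linarith
    then show ?thesis by (simp add: m power_mult add.commute del: binomial_Suc_Suc)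
  qed
qed

section \<open>The construction of many balanced independent sets\<close>

lemma count_list_map_Not: "count_list (map Not x) True = length x - count_list x True"
  by (induction x) (auto simp: Suc_diff_le count_le_length)

lemma bij_betw_map_Not_high_low:
  "bij_betw (map Not) {x \<in> binary_strings m. m + 1 < 2 * count_list x True}
    {x \<in> binary_strings m. 2 * count_list x True + 1 < m}"
proof (rule bij_betw_byWitness[where f' = "map Not"])
  show "map Not ` {x \<in> binary_strings m. m + 1 < 2 * count_list x True}
      \<subseteq> {x \<in> binary_strings m. 2 * count_list x True + 1 < m}"
  proof safe
    fix x assume "x \<in> binary_strings m" "m + 1 < 2 * count_list x True"
    then show "map Not x \<in> binary_strings m" "2 * count_list (map Not x) True + 1 < m"
      using count_le_length[of x True] by (auto simp: binary_strings_def count_list_map_Not)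
  qed
qed (auto simp: binary_strings_def count_list_map_Not comp_def)

text \<open>Weights are taken on tails, so that complementation gives both sides exactly the same
  size \<open>a m\<close>. Parity excludes edges within a side. Between the sides tail weights
  differ by at least 2, whereas adjacent vertices have equal or adjacent tails.\<close>

lemma bis_lower:
  defines "a \<equiv> \<lambda>m. card {x \<in> binary_strings m. 2 * count_list x True + 1 < m}"
  shows "(2 * a m) choose a m \<le> bis (Suc m)"
proof -
  define E where "E = parcs (hypercube (Suc m))"
  define A where "A = {x \<in> even_vertices (Suc m). 2 * count_list (tl x) True + 1 < m}"
  define B where "B = {x \<in> odd_vertices (Suc m). m + 1 < 2 * count_list (tl x) True}"
  have "bij_betw tl A {x \<in> binary_strings m. 2 * count_list x True + 1 < m}"
    using bij_betw_tl_even[of m] unfolding A_def by (auto simp: bij_betw_def inj_on_def)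
  then have cA: "card A = a m" unfolding a_def by (rule bij_betw_same_card)
  have "bij_betw tl B {x \<in> binary_strings m. m + 1 < 2 * count_list x True}"
    using bij_betw_tl_odd[of m] unfolding B_def by (auto simp: bij_betw_def inj_on_def)
  from bij_betw_same_card[OF bij_betw_trans[OF this bij_betw_map_Not_high_low]]
  have cB: "card B = a m" by (simp add: a_def)
  have finA: "finite A" and finB: "finite B"
    by (auto simp: A_def B_def even_vertices_eq odd_vertices_eq finite_binary_strings)
  have disj: "A \<inter> B = {}" by (auto simp: A_def B_def)
  have V: "A \<union> B \<subseteq> binary_strings (Suc m)"
    by (auto simp: A_def B_def even_vertices_eq odd_vertices_eq)
  have indep: "(x, y) \<notin> E" if x: "x \<in> A \<union> B" and y: "y \<in> A \<union> B" for x y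
  proof
    assume "(x, y) \<in> E"
    then have xy: "y \<in> flips x" by (simp add: E_def parcs_hypercube)
    have "x \<noteq> []" using x V by (auto simp: binary_strings_def)
    then obtain b z where "x = b # z" by (cases x) auto
    then have "tl y = tl x \<or> tl y \<in> flips (tl x)" using xy by auto
    then have "count_list (tl y) True \<le> Suc (count_list (tl x) True) \<and> count_list (tl x) True \<le> Suc (count_list (tl y) True)"
      using weight_flips by auto
    moreover have "even (count_list y True) \<longleftrightarrow> odd (count_list x True)" using parity_flips[OF xy] .
    ultimately show False using x y by (auto simp: A_def B_def even_vertices_eq odd_vertices_eq)
  qed
  have "card {Z. Z \<subseteq> A \<union> B \<and> card Z = a m} \<le> bis (Suc m)"
    unfolding bis_def
  \<comment> \<open>Bijective form of Vandermonde's identity: complementing \<open>Z\<close> within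
    \<open>A\<close> turns \<open>card Z = a m\<close> into balance, since \<open>A - Z\<close> and
    \<open>Z \<inter> B\<close> both have \<open>a m - card (A \<inter> Z)\<close> elements.\<close>
  proof (rule card_inj_on_le[where f = "\<lambda>Z. (A - Z) \<union> (Z \<inter> B)"])
    show "inj_on (\<lambda>Z. (A - Z) \<union> (Z \<inter> B)) {Z. Z \<subseteq> A \<union> B \<and> card Z = a m}"
    proof (rule inj_onI)
      fix Z W assume "Z \<in> {Z. Z \<subseteq> A \<union> B \<and> card Z = a m}" "W \<in> {Z. Z \<subseteq> A \<union> B \<and> card Z = a m}"
        and eq: "(A - Z) \<union> (Z \<inter> B) = (A - W) \<union> (W \<inter> B)"
      then have sub: "Z \<subseteq> A \<union> B" "W \<subseteq> A \<union> B" by auto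
      have "x \<in> Z \<longleftrightarrow> x \<in> W" for x
        using sub disj eq[unfolded set_eq_iff, rule_format, of x] by auto
      then show "Z = W" by auto
    qed
    show "(\<lambda>Z. (A - Z) \<union> (Z \<inter> B)) ` {Z. Z \<subseteq> A \<union> B \<and> card Z = a m}
        \<subseteq> {I. independent_set (hypercube (Suc m)) I \<and> balanced (Suc m) I}"
    proof safe
      fix Z assume Z: "Z \<subseteq> A \<union> B" "card Z = a m"
      let ?I = "(A - Z) \<union> (Z \<inter> B)"
      show "independent_set (hypercube (Suc m)) ?I"
        using V indep unfolding independent_set_def pverts_hypercube E_def by auto
      have "?I \<inter> even_vertices (Suc m) = A - Z" "?I \<inter> odd_vertices (Suc m) = Z \<inter> B"
        by (auto simp: A_def B_def even_vertices_eq odd_vertices_eq)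
      moreover have "card (A - Z) + card (A \<inter> Z) = card A"
        using finA by (subst card_Un_disjoint[symmetric]) (auto intro: arg_cong[where f = card])
      moreover have "card (Z \<inter> B) + card (A \<inter> Z) = card Z"
        using finA finB disj Z(1) by (subst card_Un_disjoint[symmetric]) (auto intro: arg_cong[where f = card])
      ultimately show "balanced (Suc m) ?I" using cA Z(2) by (simp add: balanced_def)
    qed
  qed (rule finite_balanced_independent_sets)
  moreover have "card (A \<union> B) = 2 * a m" using finA finB disj cA cB by (simp add: card_Un_disjoint)
  ultimately show ?thesis using n_subsets[of "A \<union> B" "a m"] finA finB by simp
qed

text \<open>Strings that are neither low nor high lie in the one or two middle layers. The second
  bound serves to show \<open>log 2 (2 * a) \<le> m\<close>.\<close>

lemma low_weight_card_bounds:
  fixes m :: nat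
  defines "a \<equiv> card {x \<in> binary_strings m. 2 * count_list x True + 1 < m}"
  shows "2 ^ m \<le> 2 * a + 2 * (m choose (m div 2))" "2 * a \<le> 2 ^ m"
proof -
  let ?L = "{x \<in> binary_strings m. 2 * count_list x True + 1 < m}"
  let ?H = "{x \<in> binary_strings m. m + 1 < 2 * count_list x True}"
  let ?W = "\<lambda>k. {x \<in> binary_strings m. count_list x True = k}"
  have L: "card ?L = a" by (simp add: a_def)
  have H: "card ?H = a" unfolding a_def by (rule bij_betw_same_card[OF bij_betw_map_Not_high_low])
  have "binary_strings m \<subseteq> ?L \<union> ?H \<union> (?W (m div 2) \<union> ?W ((m + 1) div 2))"
    by auto
  then have "card (binary_strings m) \<le> card (?L \<union> ?H \<union> (?W (m div 2) \<union> ?W ((m + 1) div 2)))"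
    by (rule card_mono[rotated]) (auto simp: finite_binary_strings)
  also have "\<dots> \<le> card (?L \<union> ?H) + card (?W (m div 2) \<union> ?W ((m + 1) div 2))" by (rule card_Un_le)
  also have "\<dots> \<le> card ?L + card ?H + (card (?W (m div 2)) + card (?W ((m + 1) div 2)))"
    by (rule add_mono) (rule card_Un_le)+
  finally have "card (binary_strings m) \<le> \<dots>" .
  moreover have "m choose ((m + 1) div 2) \<le> m choose (m div 2)" by (rule binomial_maximum)
  ultimately show "2 ^ m \<le> 2 * a + 2 * (m choose (m div 2))"
    unfolding L H by (simp add: card_binary_strings card_weight_layer)
  have "card ?L + card ?H = card (?L \<union> ?H)"
    by (intro card_Un_disjoint[symmetric]) (auto simp: finite_binary_strings)
  also have "\<dots> \<le> card (binary_strings m)"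
    by (intro card_mono) (auto simp: finite_binary_strings)
  finally show "2 * a \<le> 2 ^ m" unfolding L H by (simp add: card_binary_strings)
qed

lemma log_bis_lower:
  "\<forall>\<^sub>F m in sequentially. (1 - 4 / sqrt (real (Suc m))) * 2 ^ m \<le> log 2 (real (bis (Suc m)))"
proof -
  \<comment> \<open>The middle layers cost 2 / sqrt m; raising the constant to 4 absorbs the loss
    \<open>m\<close> from \<open>4 ^ a / (2 * a)\<close> and the shift from \<open>m\<close> to
    \<open>Suc m\<close>.\<close>
  have "\<forall>\<^sub>F m in sequentially. 2 ^ m * (1 - 4 / sqrt (real (Suc m))) \<le> 2 ^ m - 2 * (2 ^ m / sqrt (real m)) - real m"
    by real_asymp
  moreover have "\<forall>\<^sub>F m in sequentially. 2 < 2 ^ m - 2 * (2 ^ m / sqrt (real m))"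
    by real_asymp
  ultimately show ?thesis using eventually_gt_at_top[of 0]
  proof eventually_elim
    case (elim m)
    define a where "a = card {x \<in> binary_strings m. 2 * count_list x True + 1 < m}"
    have "real (m choose (m div 2)) \<le> 2 ^ m / sqrt (real m)"
      using middle_binomial_upper[of m] elim(3) by (simp add: pos_le_divide_eq)
    moreover have "2 ^ m \<le> 2 * real a + 2 * real (m choose (m div 2))"
      using low_weight_card_bounds(1)[of m, folded a_def, THEN of_nat_mono, where 'a = real] by simp
    ultimately have a: "2 ^ m - 2 * (2 ^ m / sqrt (real m)) \<le> 2 * real a" by linarith
    then have a0: "a > 0" using elim(2) by (cases "a = 0") auto
    have "2 * a \<le> 2 ^ m" unfolding a_def by (rule low_weight_card_bounds(2))
    then have "2 * real a \<le> 2 powr real m"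
      using of_nat_mono[of "2 * a" "2 ^ m", where 'a = real] by (simp add: powr_realpow)
    then have la: "log 2 (2 * real a) \<le> real m" using a0 by (simp add: log_le_iff)
    have "4 ^ a / (2 * real a) \<le> real ((2 * a) choose a)"
      using central_binomial_lower_bound[OF a0] by simp
    also have "\<dots> \<le> real (bis (Suc m))" using bis_lower[of m] by (simp add: a_def)
    finally have "log 2 (4 ^ a / (2 * real a)) \<le> log 2 (real (bis (Suc m)))"
      using a0 by (intro log_mono) auto
    moreover have "log 2 (4 ^ a / (2 * real a)) = 2 * real a - log 2 (2 * real a)"
    proof -
      have "(4::real) ^ a = 2 powr (2 * real a)" by (simp add: powr_realpow[symmetric] powr_powr[symmetric])
      then show ?thesis using a0 by (subst log_divide) auto
    qed
    ultimately show ?case using a la elim(1) by (simp add: mult.commute)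
  qed
qed

theorem theorem1p1:
  shows "\<exists>c\<^sub>1 c\<^sub>2 :: real. c\<^sub>1 > 0 \<and> c\<^sub>2 > 0 \<and>
    (\<forall>\<^sub>F d in sequentially.
       (1 - c\<^sub>1 / sqrt (real d)) * (real (card (pverts (hypercube d))) / 2)
         \<le> log 2 (real (bis d)) \<and>
       log 2 (real (bis d))
         \<le> (1 - c\<^sub>2 / sqrt (real d)) * (real (card (pverts (hypercube d))) / 2))"
proof (intro exI conjI)
  let ?P = "\<lambda>d. (1 - 4 / sqrt (real d)) * (real (card (pverts (hypercube d))) / 2)
         \<le> log 2 (real (bis d)) \<and>
       log 2 (real (bis d))
         \<le> (1 - (1 / 5242880) / sqrt (real d)) * (real (card (pverts (hypercube d))) / 2)"
  \<comment> \<open>For dimension \<open>Suc m\<close>, half the number of vertices is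
    \<open>2 ^ m\<close>.\<close>
  have "\<forall>\<^sub>F m in sequentially. ?P (Suc m)"
    using log_bis_lower log_bis_upper
    by eventually_elim (simp add: card_hypercube)
  then show "\<forall>\<^sub>F d in sequentially. ?P d"
    by (rule eventually_sequentially_Suc[of ?P, THEN iffD1])
qed auto


end
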